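(* Let $\gamma$ be a cooriented wave front in the plane (possibly with cusps), and for $\ell>0$ let $\Gamma_\ell=T_\ell(\gamma)$ be the curve traced by the end points of the tangent segments of length $\ell$ to $\gamma$. Then $\Gamma_\ell$ is a smooth (immersed) curve for all $\ell>0$.
   Context: Let $M=\{(x,y,\theta)\}=\mathbb{R}^2\times S^1$ be the configuration space of oriented segments $AB$ of length $\ell$ in the plane: $A=(x,y)$ is the foot point (rear wheel) and $\theta$ is the angle between the $x$-axis and the segment. $M$ carries the contact structure given by the kernel of the 1-form $\lambda=\sin\theta\,dx-\cos\theta\,dy$. A smooth immersed curve in $M$ is Legendrian if it is everywhere tangent to the contact planes. A (cooriented) wave front $\gamma$ is the image of a Legendrian curve $\tilde\gamma$ under the projection $p:(x,y,\theta)\mapsto(x,y)$; it may have singularities (generically semicubical cusps) where $\tilde\gamma$ is tangent to the fibers of $p$, but it has a well defined tangent line at every point, and $\tilde\gamma$ is its Legendrian lift; the coorientation amounts to the continuous choice of direction $\theta$ of the tangent segments. The curve $\Gamma_\ell=T_\ell(\gamma)$ is the image of $\tilde\gamma$ under the map $p_1:(x,y,\theta)\mapsto(x+\ell\cos\theta,\,y+\ell\sin\theta)$ (the front wheel track of a bicycle of length $\ell$ with rear wheel track $\gamma$). *)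

theory Defs
  imports "HOL-Analysis.Analysis"
begin

(* The circle of directions is the unit circle in the complex plane: the angle theta is the
   point cis theta.  Thus (x, y, theta) is written (x, y, u) with u = cis theta,
   Re u = cos theta, Im u = sin theta, and M is an embedded submanifold of R^2 x C. *)

type_synonym plane = "real \<times> real"
type_synonym ambient = "real \<times> real \<times> complex"

definition M :: "ambient set" where
  "M = {(x, y, u) | x y u. u \<in> sphere 0 1}"

definition tangent_space_M :: "ambient \<Rightarrow> ambient set" where
  "tangent_space_M = (\<lambda>(x, y, u). {(a, b, w) | a b w. u \<bullet> w = 0})"

(* lambda = sin theta dx - cos theta dy; the first argument is the base point *)
definition contact_form :: "ambient \<Rightarrow> ambient \<Rightarrow> real" where
  "contact_form = (\<lambda>(x, y, u) (a, b, w). Im u * a - Re u * b)"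

lemma contact_form_cis:
  "contact_form (x, y, cis \<theta>) (dx, dy, w) = sin \<theta> * dx - cos \<theta> * dy"
  by (simp add: contact_form_def)

definition contact_plane :: "ambient \<Rightarrow> ambient set" where
  "contact_plane q = {v \<in> tangent_space_M q. contact_form q v = 0}"

(* C-infinity on a set of parameters; D n is the n-th derivative of f.  At an end point
   belonging to S, derivatives are one-sided. *)
definition smooth_on :: "real set \<Rightarrow> (real \<Rightarrow> 'a::real_normed_vector) \<Rightarrow> bool" where
  "smooth_on S f \<longleftrightarrow>
     (\<exists>D. D 0 = f \<and>
       (\<forall>n. \<forall>t\<in>S. (D n has_vector_derivative D (Suc n) t) (at t within S)))"

(* Parameter domains are arbitrary nondegenerate intervals, bounded or not.  Closed curves are
   the periodic maps on UNIV. *)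
definition param_interval :: "real set \<Rightarrow> bool" where
  "param_interval I \<longleftrightarrow> is_interval I \<and> (\<exists>a\<in>I. \<exists>b\<in>I. a < b)"

definition immersed_curve :: "real set \<Rightarrow> (real \<Rightarrow> 'a::real_normed_vector) \<Rightarrow> bool" where
  "immersed_curve I c \<longleftrightarrow>
     param_interval I \<and> smooth_on I c \<and> (\<forall>t\<in>I. vector_derivative c (at t within I) \<noteq> 0)"

definition legendrian :: "real set \<Rightarrow> (real \<Rightarrow> ambient) \<Rightarrow> bool" where
  "legendrian I L \<longleftrightarrow>
     L ` I \<subseteq> M \<and> immersed_curve I L \<and>
     (\<forall>t\<in>I. vector_derivative L (at t within I) \<in> contact_plane (L t))"

definition foot_point :: "ambient \<Rightarrow> plane" where
  "foot_point = (\<lambda>(x, y, u). (x, y))"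

definition end_point :: "real \<Rightarrow> ambient \<Rightarrow> plane" where
  "end_point l = (\<lambda>(x, y, u). (x + l * Re u, y + l * Im u))"

lemma end_point_cis: "end_point l (x, y, cis \<theta>) = (x + l * cos \<theta>, y + l * sin \<theta>)"
  by (simp add: end_point_def)

(* A front carries its Legendrian lift L as data: L is the coorientation, and the planar curve
   alone does not determine it (for instance where the front is constant). *)
definition cooriented_wave_front ::
    "real set \<Rightarrow> (real \<Rightarrow> plane) \<Rightarrow> (real \<Rightarrow> ambient) \<Rightarrow> bool" where
  "cooriented_wave_front I \<gamma> L \<longleftrightarrow> legendrian I L \<and> (\<forall>t\<in>I. \<gamma> t = foot_point (L t))"

(* T_l of the front with Legendrian lift L *)
definition front_track :: "real \<Rightarrow> (real \<Rightarrow> ambient) \<Rightarrow> real \<Rightarrow> plane" where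
  "front_track l L = end_point l \<circ> L"

end

theory Submission
  imports Defs
begin

text \<open>The map sending a segment to its end point is linear on the ambient space, so it preserves
  smoothness. On a contact plane a kernel vector \<open>(a, b, w)\<close> satisfies
  \<open>(a, b) = - l w\<close>; the contact condition says that \<open>(a, b)\<close> is parallel to the direction
  \<open>u\<close>, while \<open>w\<close> is orthogonal to \<open>u\<close>, so the vector vanishes. Thus the map is injective on
  contact planes and takes Legendrian immersions to immersions.\<close>

lemma bounded_linear_end_point: "bounded_linear (end_point l)"
proof -
  \<comment> \<open>Replacing the pattern match by projections exposes a form built from linear
    maps.\<close>
  have "end_point l = (\<lambda>p. (fst p + l * Re (snd (snd p)), fst (snd p) + l * Im (snd (snd p))))"
    by (auto simp: end_point_def fun_eq_iff)
  moreover have "bounded_linear \<dots>"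
    by (intro bounded_linear_Pair bounded_linear_add bounded_linear_const_mult
        bounded_linear_compose[OF bounded_linear_Re] bounded_linear_compose[OF bounded_linear_Im]
        bounded_linear_compose[OF bounded_linear_fst] bounded_linear_compose[OF bounded_linear_snd]
        bounded_linear_fst bounded_linear_snd)
  ultimately show ?thesis by simp
qed

lemma smooth_on_bounded_linear_compose:
  assumes f: "bounded_linear f" and c: "smooth_on S c"
  shows "smooth_on S (f \<circ> c)"
proof -
  obtain D where D: "D 0 = c"
    "\<And>n t. t \<in> S \<Longrightarrow> (D n has_vector_derivative D (Suc n) t) (at t within S)"
    using c by (auto simp: smooth_on_def)
  \<comment> \<open>Since \<open>f\<close> is its own derivative, applying it to every member of the
    sequence \<open>D\<close> again gives a sequence of successive derivatives.\<close>
  have "((f \<circ> D n) has_vector_derivative (f \<circ> D (Suc n)) t) (at t within S)" if "t \<in> S" for n t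
    using bounded_linear.has_vector_derivative[OF f D(2)[OF that]] by (simp add: o_def)
  then show ?thesis
    using D(1) by (auto simp: smooth_on_def intro!: exI[of _ "\<lambda>n. f \<circ> D n"])
qed

lemma smooth_on_imp_differentiable:
  assumes "smooth_on S c" "t \<in> S"
  shows "c differentiable (at t within S)"
  using assms unfolding smooth_on_def by (metis differentiableI_vector)

text \<open>A connected set with more than one point has no isolated points. This makes one-sided
  derivatives at end points unique, so that \<open>vector_derivative\<close> can be computed
  there.\<close>

lemma param_interval_at_within_nontrivial:
  assumes "param_interval I" "t \<in> I"
  shows "at t within I \<noteq> bot"
proof -
  have "connected I" "\<nexists>x. I = {x}"
    using assms(1) by (auto simp: param_interval_def is_interval_connected)
  then show ?thesis
    using connected_imp_perfect[of I t] assms(2) by (auto simp: trivial_limit_within)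
qed

lemma end_point_inj_on_contact_plane:
  assumes q: "q \<in> M" and v: "v \<in> contact_plane q" and l: "l \<noteq> 0" and 0: "end_point l v = 0"
  shows "v = 0"
proof -
  obtain x y u where q_eq: "q = (x, y, u)" by (cases q)
  obtain a b w where v_eq: "v = (a, b, w)" by (cases v)
  have u: "u \<noteq> 0" using q by (auto simp: q_eq M_def)
  have orth: "Re u * Re w + Im u * Im w = 0" and contact: "Im u * a = Re u * b"
    using v by (auto simp: q_eq v_eq contact_plane_def tangent_space_M_def contact_form_def
        inner_complex_def)
  have a: "a = - l * Re w" and b: "b = - l * Im w"
    using 0 by (auto simp: v_eq end_point_def zero_prod_def)
  \<comment> \<open>Substituting \<open>a\<close> and \<open>b\<close> turns the contact condition
    into parallelism of \<open>w\<close> and \<open>u\<close>.\<close>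
  have "l * (Im u * Re w - Re u * Im w) = 0"
    using contact by (simp add: a b algebra_simps)
  with l have par: "Im u * Re w = Re u * Im w" by simp
  \<comment> \<open>\<open>orth\<close> and \<open>par\<close> form a linear system for
    \<open>Re w\<close> and \<open>Im w\<close> with determinant
    \<open>- ((Re u)\<^sup>2 + (Im u)\<^sup>2)\<close>; each identity eliminates one
    unknown.\<close>
  have "((Re u)\<^sup>2 + (Im u)\<^sup>2) * Re w = 0" "((Re u)\<^sup>2 + (Im u)\<^sup>2) * Im w = 0"
  proof -
    have "((Re u)\<^sup>2 + (Im u)\<^sup>2) * Re w =
        Re u * (Re u * Re w + Im u * Im w) + Im u * (Im u * Re w - Re u * Im w)"
      by (simp add: power2_eq_square algebra_simps)
    then show "((Re u)\<^sup>2 + (Im u)\<^sup>2) * Re w = 0" by (simp add: orth par)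
    have "((Re u)\<^sup>2 + (Im u)\<^sup>2) * Im w =
        Im u * (Re u * Re w + Im u * Im w) - Re u * (Im u * Re w - Re u * Im w)"
      by (simp add: power2_eq_square algebra_simps)
    then show "((Re u)\<^sup>2 + (Im u)\<^sup>2) * Im w = 0" by (simp add: orth par)
  qed
  moreover have "(Re u)\<^sup>2 + (Im u)\<^sup>2 \<noteq> 0"
    using u by (simp add: complex_eq_iff sum_power2_eq_zero_iff)
  ultimately have "w = 0" by (auto simp: complex_eq_iff)
  then show ?thesis by (simp add: v_eq a b zero_prod_def)
qed

theorem lemma2p2:
  fixes I :: "real set" and \<gamma> :: "real \<Rightarrow> plane" and L :: "real \<Rightarrow> ambient"
  assumes "cooriented_wave_front I \<gamma> L"
  shows "\<forall>l>0. immersed_curve I (front_track l L)"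
proof (intro allI impI)
  fix l :: real
  assume l: "l > 0"
  have L: "L ` I \<subseteq> M" and I: "param_interval I" and smooth: "smooth_on I L"
    and nz: "\<And>t. t \<in> I \<Longrightarrow> vector_derivative L (at t within I) \<noteq> 0"
    and contact: "\<And>t. t \<in> I \<Longrightarrow> vector_derivative L (at t within I) \<in> contact_plane (L t)"
    using assms by (auto simp: cooriented_wave_front_def legendrian_def immersed_curve_def)
  have "vector_derivative (front_track l L) (at t within I) \<noteq> 0" if t: "t \<in> I" for t
  proof -
    have "(L has_vector_derivative vector_derivative L (at t within I)) (at t within I)"
      using smooth_on_imp_differentiable[OF smooth t] by (simp add: vector_derivative_works)
    \<comment> \<open>By linearity, \<open>end_point l\<close> acts on velocities by the same
      formula as on points, so the injectivity lemma applies to it directly.\<close>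
    then have "(front_track l L has_vector_derivative
        end_point l (vector_derivative L (at t within I))) (at t within I)"
      using bounded_linear.has_vector_derivative[OF bounded_linear_end_point]
      by (simp add: front_track_def o_def)
    then have "vector_derivative (front_track l L) (at t within I) =
        end_point l (vector_derivative L (at t within I))"
      by (rule vector_derivative_within[OF param_interval_at_within_nontrivial[OF I t]])
    then show ?thesis
      using end_point_inj_on_contact_plane[OF _ contact[OF t], of l] L t l nz[OF t] by auto
  qed
  then show "immersed_curve I (front_track l L)"
    using I smooth_on_bounded_linear_compose[OF bounded_linear_end_point smooth]
    by (simp add: immersed_curve_def front_track_def)
qed

end
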